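(* Let $2\le d<+\infty$ and let $\boldsymbol{S}=\{\mathrm{S}_1,\mathrm{S}_2\}$ be an arbitrary pair of real $d\times d$ matrices, one of which has rank $1$. If $\rho(A)<1$ for all $A\in\boldsymbol{S}^+$, then $\rho(\boldsymbol{S})<1$; namely, the switched dynamics induced by $\boldsymbol{S}$ is absolutely asymptotically stable and absolutely exponentially stable.
   Context: For a square real matrix $A$, $\rho(A)$ denotes its usual spectral radius (largest modulus of a complex eigenvalue). For a pair $\boldsymbol{S}=\{\mathrm{S}_1,\mathrm{S}_2\}\subset\mathbb{R}^{d\times d}$, the generalized spectral radius is $$\rho(\boldsymbol{S})=\limsup_{n\to+\infty}\left\{\max_{(i_1,\ldots,i_n)\in\{1,2\}^n}\sqrt[n]{\rho(\mathrm{S}_{i_1}\cdots\mathrm{S}_{i_n})}\right\}.$$ $\boldsymbol{S}^+$ denotes the multiplicative semigroup generated by $\mathrm{S}_1,\mathrm{S}_2$, i.e. the collection of all products $\mathrm{S}_{i_1}\cdots\mathrm{S}_{i_n}$ with $n\ge1$ and $(i_1,\ldots,i_n)\in\{1,2\}^n$. Let $\|\cdot\|$ be any matrix norm on $\mathbb{R}^{d\times d}$ and $\mathbb{N}=\{1,2,\ldots\}$. A switching signal is a map $\mathbb{N}\to\{1,2\}$, $n\mapsto i_n$. The switched dynamics induced by $\boldsymbol{S}$ is $x_n=x_0\mathrm{S}_{i_1}\cdots\mathrm{S}_{i_n}$, for row vectors $x_0\in\mathbb{R}^d$, $n\ge1$ and switching signals $(i_n)_{n\ge1}$. It is absolutely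 asymptotically stable if $\|\mathrm{S}_{i_1}\cdots\mathrm{S}_{i_n}\|\to0$ as $n\to+\infty$ for every switching signal, and absolutely exponentially stable if $\limsup_{n\to+\infty}\frac1n\log\|\mathrm{S}_{i_1}\cdots\mathrm{S}_{i_n}\|<0$ for every switching signal (with $\log 0=-\infty$). *)

theory Defs
  imports
    "Jordan_Normal_Form.Spectral_Radius"
    "Jordan_Normal_Form.DL_Rank"
    "HOL-Library.Extended_Real"
    "HOL-Library.Liminf_Limsup"
begin

text \<open>
  Throughout, the pair of matrices is given by a family \<open>S\<close> of which only the members
  \<open>S 1\<close> and \<open>S 2\<close> matter, and a word \<open>(i\<^sub>1, \<dots>, i\<^sub>n)\<close> over the alphabet \<open>{1, 2}\<close> is a list.
\<close>

definition rho :: "real mat \<Rightarrow> real" where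
  "rho A = spectral_radius (map_mat complex_of_real A)"

definition words :: "nat \<Rightarrow> nat list set" where
  "words n = {w. length w = n \<and> set w \<subseteq> {1, 2}}"

text \<open>\<open>word_prod d S [i\<^sub>1, \<dots>, i\<^sub>n]\<close> is \<open>S i\<^sub>1 * \<dots> * S i\<^sub>n\<close>, in this order.\<close>

definition word_prod :: "nat \<Rightarrow> (nat \<Rightarrow> real mat) \<Rightarrow> nat list \<Rightarrow> real mat" where
  "word_prod d S w = foldr (\<lambda>i A. S i * A) w (1\<^sub>m d)"

definition semigroup_gen :: "nat \<Rightarrow> (nat \<Rightarrow> real mat) \<Rightarrow> real mat set" where
  "semigroup_gen d S = {word_prod d S w | w n. n \<ge> 1 \<and> w \<in> words n}"

text \<open>
  The limit superior is formed in the extended reals, so that no boundedness has to be presupposed.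
  The term for \<open>n = 0\<close> is irrelevant, here and in the limits below.
\<close>

definition generalized_spectral_radius :: "nat \<Rightarrow> (nat \<Rightarrow> real mat) \<Rightarrow> ereal" where
  "generalized_spectral_radius d S =
     limsup (\<lambda>n. ereal (MAX w\<in>words n. root n (rho (word_prod d S w))))"

text \<open>
  A norm on the vector space of real \<open>d \<times> d\<close> matrices; submultiplicativity is not required, so
  submultiplicative norms are included as a special case.
\<close>

definition matrix_norm :: "nat \<Rightarrow> (real mat \<Rightarrow> real) \<Rightarrow> bool" where
  "matrix_norm d N \<longleftrightarrow>
     (\<forall>A\<in>carrier_mat d d. N A \<ge> 0) \<and>
     (\<forall>A\<in>carrier_mat d d. N A = 0 \<longleftrightarrow> A = 0\<^sub>m d d) \<and>
     (\<forall>c. \<forall>A\<in>carrier_mat d d. N (c \<cdot>\<^sub>m A) = \<bar>c\<bar> * N A) \<and>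
     (\<forall>A\<in>carrier_mat d d. \<forall>B\<in>carrier_mat d d. N (A + B) \<le> N A + N B)"

text \<open>A switching signal is indexed by \<open>n \<ge> 1\<close>; its value at \<open>0\<close> is never used.\<close>

definition switching_signal :: "(nat \<Rightarrow> nat) \<Rightarrow> bool" where
  "switching_signal i \<longleftrightarrow> (\<forall>n\<ge>1. i n \<in> {1, 2})"

text \<open>
  The transition matrix \<open>S (i 1) * \<dots> * S (i n)\<close>: the switched dynamics driven by the signal \<open>i\<close>
  takes the row vector \<open>x\<^sub>0\<close> to \<open>x\<^sub>n = x\<^sub>0 * signal_prod d S i n\<close>.
\<close>

definition signal_prod :: "nat \<Rightarrow> (nat \<Rightarrow> real mat) \<Rightarrow> (nat \<Rightarrow> nat) \<Rightarrow> nat \<Rightarrow> real mat" where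
  "signal_prod d S i n = word_prod d S (map i [1..<Suc n])"

definition absolutely_asymptotically_stable ::
    "(real mat \<Rightarrow> real) \<Rightarrow> nat \<Rightarrow> (nat \<Rightarrow> real mat) \<Rightarrow> bool" where
  "absolutely_asymptotically_stable N d S \<longleftrightarrow>
     (\<forall>i. switching_signal i \<longrightarrow> (\<lambda>n. N (signal_prod d S i n)) \<longlonglongrightarrow> 0)"

text \<open>The logarithm on \<open>[0, \<infinity>)\<close> with \<open>log 0 = -\<infinity>\<close> (the HOL function has \<open>ln 0 = 0\<close>).\<close>

definition elog :: "real \<Rightarrow> ereal" where
  "elog x = (if x = 0 then -\<infinity> else ereal (ln x))"

definition absolutely_exponentially_stable ::
    "(real mat \<Rightarrow> real) \<Rightarrow> nat \<Rightarrow> (nat \<Rightarrow> real mat) \<Rightarrow> bool" where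
  "absolutely_exponentially_stable N d S \<longleftrightarrow>
     (\<forall>i. switching_signal i \<longrightarrow>
        limsup (\<lambda>n. ereal (1 / real n) * elog (N (signal_prod d S i n))) < 0)"

end

theory Submission
  imports Defs
begin

text \<open>
  Let \<open>A\<close> be the member of rank one and \<open>B\<close> the other one. Write \<open>A = U V\<close> with a column \<open>U\<close> and
  a row \<open>V\<close> (\<open>rank_le_one_factorization\<close>). Cutting a word at its occurrences of \<open>A\<close> shows that its
  product a power of \<open>B\<close> or
  \<open>B^k\<^sub>0 U \<cdot> (V B^k\<^sub>1 U) \<cdots> (V B^k\<^sub>m\<^sub>-\<^sub>1 U) \<cdot> V B^k\<^sub>m\<close>,
  in which the factors in the middle are values of the scalar sequence \<open>c\<^sub>k = V B\<^sup>k U\<close>. The matrix \<open>A B\<^sup>k\<close> also has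
  rank at most one, and \<open>c\<^sub>k\<close> is its only possible nonzero eigenvalue. So the hypothesis on the
  semigroup gives \<open>\<bar>c\<^sub>k\<bar> < 1\<close> for every \<open>k\<close> (\<open>abs_row_times_column_le_rho\<close>). This alone would
  allow \<open>\<bar>c\<^sub>k\<bar>\<close> to approach \<open>1\<close>, but \<open>\<rho>(B) < 1\<close> makes \<open>B\<^sup>k\<close>, and with it \<open>c\<^sub>k\<close>, decay geometrically.
  Hence only finitely many of the inequalities matter, and there is a single \<open>g < 1\<close> with
  \<open>\<bar>c\<^sub>k\<bar> \<le> g\<^sup>k\<^sup>+\<^sup>1\<close> for all \<open>k\<close> (\<open>uniform_geometric_bound\<close>). Since the block \<open>A B\<^sup>k\<close> has length
  \<open>k + 1\<close>, every product of length \<open>n\<close> has entries of size at most \<open>M g\<^sup>n\<close>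
  (\<open>word_prod_geometric_bound\<close>).

  All conclusions follow from this one uniform bound: a matrix norm and the spectral radius are both
  at most a constant times the largest entry, and the constant disappears in the \<open>n\<close>-th root and in
  \<open>1/n\<close> times the logarithm.
\<close>

section \<open>Spectral radius and size of entries\<close>

lemma rho_nonneg:
  assumes "A \<in> carrier_mat d d" "0 < d"
  shows "0 \<le> rho A"
proof -
  have "map_mat complex_of_real A \<in> carrier_mat d d" using assms by simp
  from spectral_radius_mem_max(1)[OF this assms(2)] show ?thesis
    unfolding rho_def by auto
qed

lemma abs_eigenvalue_le_rho:
  assumes A: "A \<in> carrier_mat d d" and d: "0 < d" and ev: "eigenvalue A c"
  shows "\<bar>c\<bar> \<le> rho A"
proof -
  let ?A = "map_mat complex_of_real A"
  have CA: "?A \<in> carrier_mat d d" using A by simp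
  have "poly (char_poly A) c = 0" using eigenvalue_root_char_poly[OF A] ev by simp
  then have "poly (char_poly ?A) (of_real c) = 0"
    by (simp add: of_real_hom.char_poly_hom[OF A] of_real_hom.poly_map_poly)
  then have "complex_of_real c \<in> spectrum ?A"
    using spectrum_root_char_poly[OF CA] by simp
  from imageI[OF this, of norm] spectral_radius_mem_max(2)[OF CA d] show ?thesis
    unfolding rho_def by fastforce
qed

text \<open>
  This is the row sum estimate: in \<open>A v = \<lambda> v\<close>, compare both sides at an entry of \<open>v\<close> of
  largest modulus.
\<close>

lemma rho_le_norm_bound:
  assumes A: "A \<in> carrier_mat d d" and d: "0 < d" and b: "norm_bound A b"
  shows "rho A \<le> real d * b"
proof -
  let ?A = "map_mat complex_of_real A"
  have CA: "?A \<in> carrier_mat d d" using A by simp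
  from spectral_radius_mem_max(1)[OF CA d] obtain l
    where l: "eigenvalue ?A l" and rho: "rho A = norm l"
    unfolding rho_def spectrum_def by auto
  from l CA obtain v where v: "v \<in> carrier_vec d" "v \<noteq> 0\<^sub>v d" and Av: "?A *\<^sub>v v = l \<cdot>\<^sub>v v"
    unfolding eigenvalue_def eigenvector_def by auto
  let ?M = "Max ((\<lambda>i. norm (v $ i)) ` {..<d})"
  have "?M \<in> (\<lambda>i. norm (v $ i)) ` {..<d}" using d by (intro Max_in) auto
  then obtain m where m: "m < d" and mM: "norm (v $ m) = ?M" by auto
  have max: "norm (v $ i) \<le> norm (v $ m)" if "i < d" for i
    unfolding mM using that by (intro Max_ge) auto
  obtain j where "j < d" "v $ j \<noteq> 0"
    using v by (metis carrier_vecD eq_vecI index_zero_vec)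
  with max[of j] have pos: "0 < norm (v $ m)" by (smt (verit) zero_less_norm_iff)
  have entry: "\<bar>A $$ (m, j)\<bar> \<le> b" if "j < d" for j
    using b A m that unfolding norm_bound_def by auto
  have "l * v $ m = (?A *\<^sub>v v) $ m" using Av v m by simp
  also have "\<dots> = (\<Sum>j<d. of_real (A $$ (m, j)) * v $ j)"
    using A v m by (simp add: scalar_prod_def atLeast0LessThan)
  finally have "norm l * norm (v $ m) = norm (\<Sum>j<d. of_real (A $$ (m, j)) * v $ j)"
    by (metis norm_mult)
  also have "\<dots> \<le> (\<Sum>j<d. b * norm (v $ m))"
  proof (rule sum_norm_le)
    fix j assume "j \<in> {..<d}"
    then show "norm (of_real (A $$ (m, j)) * v $ j) \<le> b * norm (v $ m)"
      using mult_mono'[OF entry max, of j j] by (simp add: norm_mult)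
  qed
  also have "\<dots> = real d * b * norm (v $ m)" by simp
  finally show ?thesis unfolding rho using pos by simp
qed

lemma pow_smult_mat:
  fixes A :: "'a :: comm_ring_1 mat"
  assumes A: "A \<in> carrier_mat d d"
  shows "(c \<cdot>\<^sub>m A) ^\<^sub>m k = c ^ k \<cdot>\<^sub>m (A ^\<^sub>m k)"
proof (induction k)
  case 0
  show ?case using A by (intro eq_matI) auto
next
  case (Suc k)
  have "(c \<cdot>\<^sub>m A) ^\<^sub>m Suc k = (c ^ k \<cdot>\<^sub>m (A ^\<^sub>m k)) * (c \<cdot>\<^sub>m A)" using Suc by simp
  also have "\<dots> = c ^ k \<cdot>\<^sub>m (c \<cdot>\<^sub>m ((A ^\<^sub>m k) * A))"
    using A pow_carrier_mat[OF A, of k] by (metis mult_smult_assoc_mat mult_smult_distrib smult_carrier_mat)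
  also have "\<dots> = c ^ Suc k \<cdot>\<^sub>m (A ^\<^sub>m Suc k)"
    by (intro eq_matI) (auto simp: mult_ac)
  finally show ?case .
qed

text \<open>
  The powers of a matrix with spectral radius below \<open>1\<close> are bounded, by its Jordan form. Applied to
  \<open>A/t\<close> with \<open>\<rho>(A) < t < 1\<close>, this becomes geometric decay.
\<close>

lemma pow_geometric_bound:
  assumes A: "A \<in> carrier_mat d d" and d: "0 < d" and rho: "rho A < 1"
  obtains M t where "0 < M" "0 < t" "t < 1" "\<And>k. norm_bound (A ^\<^sub>m k) (M * t ^ k)"
proof -
  let ?A = "map_mat complex_of_real A"
  have CA: "?A \<in> carrier_mat d d" using A by simp
  \<comment> \<open>Any number strictly between \<open>\<rho>(A)\<close> and \<open>1\<close> would do.\<close>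
  define t where "t = (1 + rho A) / 2"
  have t: "0 < t" "t < 1" "rho A < t"
    using rho rho_nonneg[OF A d] unfolding t_def by auto
  define T where "T = complex_of_real (1 / t)"
  let ?B = "T \<cdot>\<^sub>m ?A"
  have CB: "?B \<in> carrier_mat d d" using CA by simp
  from spectral_radius_mem_max(1)[OF CB d] obtain l
    where l: "eigenvalue ?B l" and sr: "spectral_radius ?B = norm l"
    unfolding spectrum_def by auto
  from l CB obtain v where v: "v \<in> carrier_vec d" "v \<noteq> 0\<^sub>v d" and Bv: "?B *\<^sub>v v = l \<cdot>\<^sub>v v"
    unfolding eigenvalue_def eigenvector_def by auto
  have "?A *\<^sub>v v = (of_real t * l) \<cdot>\<^sub>v v"
  proof -
    have "?B *\<^sub>v v = T \<cdot>\<^sub>v (?A *\<^sub>v v)"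
      using CA v by (intro eq_vecI) auto
    then have "of_real t \<cdot>\<^sub>v (T \<cdot>\<^sub>v (?A *\<^sub>v v)) = of_real t \<cdot>\<^sub>v (l \<cdot>\<^sub>v v)" using Bv by simp
    then show ?thesis using t by (simp add: smult_smult_assoc T_def)
  qed
  then have "of_real t * l \<in> spectrum ?A"
    unfolding spectrum_def eigenvalue_def eigenvector_def using v CA by auto
  from imageI[OF this, of norm] spectral_radius_mem_max(2)[OF CA d]
  have "norm (of_real t * l) \<le> rho A" unfolding rho_def by blast
  then have "t * norm l \<le> rho A" using t by (simp add: norm_mult)
  with t(3) have "t * norm l < t * 1" by linarith
  then have "spectral_radius ?B < 1" unfolding sr using t(1) by (rule mult_left_less_imp_less[OF _ less_imp_le])
  from spectral_radius_jnf_norm_bound_less_1_upper_triangular[OF CB this]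
  obtain c where c: "\<And>k. norm_bound (?B ^\<^sub>m k) c" by blast
  have "norm_bound (A ^\<^sub>m k) (max c 1 * t ^ k)" for k
  proof
    fix i j assume "i < dim_row (A ^\<^sub>m k)" "j < dim_col (A ^\<^sub>m k)"
    then have ij: "i < d" "j < d" using pow_carrier_mat[OF A, of k] by auto
    have "(?B ^\<^sub>m k) $$ (i, j) = of_real ((1 / t) ^ k * (A ^\<^sub>m k) $$ (i, j))"
      using ij carrier_matD[OF pow_carrier_mat[OF A, of k]]
      unfolding pow_smult_mat[OF CA] of_real_hom.mat_hom_pow[OF A, symmetric] T_def
      by simp
    moreover have "norm ((?B ^\<^sub>m k) $$ (i, j)) \<le> c"
      using c[of k] ij carrier_matD[OF pow_carrier_mat[OF CB, of k]]
      unfolding norm_bound_def by metis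
    ultimately have "\<bar>(1 / t) ^ k * (A ^\<^sub>m k) $$ (i, j)\<bar> \<le> c" by (metis norm_of_real)
    then have "\<bar>(A ^\<^sub>m k) $$ (i, j)\<bar> \<le> c * t ^ k"
      using t by (simp add: abs_mult power_one_over field_simps)
    also have "\<dots> \<le> max c 1 * t ^ k" using t by (intro mult_right_mono) auto
    finally show "norm ((A ^\<^sub>m k) $$ (i, j)) \<le> max c 1 * t ^ k" by simp
  qed
  with t show thesis by (intro that[of "max c 1" t]) auto
qed

section \<open>Matrices of rank one\<close>

lemma (in vec_space) rank_le_one_factorization:
  assumes A: "A \<in> carrier_mat n m" and rank: "rank A \<le> 1"
  obtains U V where "U \<in> carrier_mat n 1" "V \<in> carrier_mat 1 m" "A = U * V"
proof -
  obtain u where u: "u \<in> carrier_vec n"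
    and mult: "\<And>j. j < m \<Longrightarrow> \<exists>c. \<forall>i<n. A $$ (i, j) = u $ i * c"
  proof (cases "A = 0\<^sub>m n m")
    case True
    then show thesis by (intro that[of "0\<^sub>v n"]) auto
  next
    case False
    obtain p q where pq: "p < n" "q < m" "A $$ (p, q) \<noteq> 0"
      using False A by (metis carrier_matD eq_matI index_zero_mat)
    \<comment> \<open>Any nonzero column spans all the others; otherwise two columns would be independent.\<close>
    let ?u = "col A q"
    have u: "?u \<in> carrier_vec n" using A by auto
    have up: "?u $ p \<noteq> 0" using pq A by simp
    show thesis
    proof (rule that[OF u])
      fix j assume j: "j < m"
      let ?w = "col A j"
      have w: "?w \<in> carrier_vec n" using A by auto
      show "\<exists>c. \<forall>i<n. A $$ (i, j) = ?u $ i * c"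
      proof (cases "?u = ?w")
        case True
        then show ?thesis using j A by (intro exI[of _ 1]) auto
      next
        case False
        let ?P = "mat_of_cols n [?u, ?w]"
        have cols: "cols ?P = [?u, ?w]" using u w by (intro cols_mat_of_cols) auto
        have sub: "{?u, ?w} \<subseteq> set (cols A)" using A pq j by (auto simp: cols_def)
        have "lin_dep {?u, ?w}"
          using rank_ge_card_indpt[OF A sub] rank False by auto
        then have dep: "lin_dep (set (cols ?P))" by (simp add: cols)
        have P: "?P \<in> carrier_mat n 2"
          using mat_of_cols_carrier(1)[of n "[?u, ?w]"] by (simp add: numeral_2_eq_2)
        obtain v where v: "v \<in> carrier_vec 2" "v \<noteq> 0\<^sub>v 2" "?P *\<^sub>v v = 0\<^sub>v n"
          using lin_depE[OF P dep] False cols by auto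
        have eq: "?u $ i * v $ 0 + ?w $ i * v $ 1 = 0" if i: "i < n" for i
        proof -
          have "(?P *\<^sub>v v) $ i = (\<Sum>k\<in>{0..<2}. row ?P i $ k * v $ k)"
            using v(1) i P by (simp add: scalar_prod_def)
          also have "\<dots> = ?u $ i * v $ 0 + ?w $ i * v $ 1"
            using i by (simp add: numeral_2_eq_2 mat_of_cols_def)
          finally show ?thesis using v(3) i by simp
        qed
        have v1: "v $ 1 \<noteq> 0"
        proof
          assume 1: "v $ 1 = 0"
          with eq[OF pq(1)] up have "v $ 0 = 0" by simp
          with 1 v(1) have "v = 0\<^sub>v 2"
            by (intro eq_vecI) (auto simp: less_2_cases_iff)
          with v(2) show False by simp
        qed
        have "A $$ (i, j) = ?u $ i * (- v $ 0 / v $ 1)" if i: "i < n" for i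
        proof -
          have "?w $ i * v $ 1 = ?u $ i * (- v $ 0)" using eq[OF i] by (simp add: eq_neg_iff_add_eq_0 add.commute)
          then have "?w $ i = ?u $ i * (- v $ 0) / v $ 1" using v1 by (metis nonzero_mult_div_cancel_right)
          then show ?thesis using i j A by simp
        qed
        then show ?thesis by blast
      qed
    qed
  qed
  from mult obtain c where c: "\<And>i j. j < m \<Longrightarrow> i < n \<Longrightarrow> A $$ (i, j) = u $ i * c j"
    by metis
  show thesis
  proof (rule that)
    show "mat n 1 (\<lambda>(i, _). u $ i) \<in> carrier_mat n 1" "mat 1 m (\<lambda>(_, j). c j) \<in> carrier_mat 1 m"
      by auto
    show "A = mat n 1 (\<lambda>(i, _). u $ i) * mat 1 m (\<lambda>(_, j). c j)"
      using A by (intro eq_matI) (auto simp: c scalar_prod_def)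
  qed
qed

lemma one_by_one_mult:
  fixes C :: "'a :: semiring_1 mat"
  assumes C: "C \<in> carrier_mat 1 1" and W: "W \<in> carrier_mat 1 m"
  shows "C * W = (C $$ (0, 0)) \<cdot>\<^sub>m W"
  using assms by (intro eq_matI) (auto simp: scalar_prod_def)

text \<open>If \<open>V U\<close> is nonzero, then \<open>U\<close> is an eigenvector: \<open>(U V) U = U (V U)\<close>.\<close>

lemma abs_row_times_column_le_rho:
  assumes U: "U \<in> carrier_mat d 1" and V: "V \<in> carrier_mat 1 d" and d: "0 < d"
  shows "\<bar>(V * U) $$ (0, 0)\<bar> \<le> rho (U * V)"
proof (cases "(V * U) $$ (0, 0) = 0")
  case True
  then show ?thesis using rho_nonneg[of "U * V" d] U V d by auto
next
  case False
  let ?c = "(V * U) $$ (0, 0)"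
  let ?u = "col U 0"
  have u: "?u \<in> carrier_vec d" using U by auto
  have c: "row V 0 \<bullet> ?u = ?c" using U V by simp
  have "?u \<noteq> 0\<^sub>v d" using False c V by auto
  moreover have "(U * V) *\<^sub>v ?u = ?c \<cdot>\<^sub>v ?u"
  proof -
    have "(U * V) *\<^sub>v ?u = U *\<^sub>v (V *\<^sub>v ?u)" using U V u by (rule assoc_mult_mat_vec)
    also have "\<dots> = ?c \<cdot>\<^sub>v ?u"
      using U V c by (intro eq_vecI) (auto simp: scalar_prod_def[of "row U _"])
    finally show ?thesis .
  qed
  ultimately have "eigenvalue (U * V) ?c"
    unfolding eigenvalue_def eigenvector_def using U u by auto
  then show ?thesis using abs_eigenvalue_le_rho[of "U * V" d] U V d by auto
qed

section \<open>A uniform bound on all products\<close>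

text \<open>
  Against any ratio in \<open>(t, 1)\<close> the decay wins from some index on. Each of the finitely
  many other inequalities holds for all \<open>g < 1\<close> close enough to \<open>1\<close>.
\<close>

lemma uniform_geometric_bound:
  fixes c :: "nat \<Rightarrow> real"
  assumes t: "0 < t" "t < 1" and decay: "\<And>k. \<bar>c k\<bar> \<le> C * t ^ k" and lt: "\<And>k. \<bar>c k\<bar> < 1"
  obtains g where "t \<le> g" "g < 1" "\<And>k. \<bar>c k\<bar> \<le> g ^ Suc k"
proof -
  define h where "h = (1 + t) / 2"
  have h: "t < h" "0 < h" "h < 1" using t unfolding h_def by auto
  have "(\<lambda>k. C / h * (t / h) ^ k) \<longlonglongrightarrow> C / h * 0"
    using t h by (intro tendsto_intros LIMSEQ_power_zero) auto
  then have "\<forall>\<^sub>F k in sequentially. C / h * (t / h) ^ k < 1"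
    by (intro order_tendstoD(2)) auto
  then obtain K where K: "\<And>k. k \<ge> K \<Longrightarrow> C / h * (t / h) ^ k < 1"
    unfolding eventually_sequentially by blast
  have large: "\<bar>c k\<bar> \<le> h ^ Suc k" if "k \<ge> K" for k
  proof -
    have "C * t ^ k \<le> h ^ Suc k"
      using K[OF that] h by (simp add: power_divide field_simps)
    with decay[of k] show ?thesis by linarith
  qed
  have "\<forall>\<^sub>F g in at_left (1::real). \<bar>c k\<bar> < g ^ Suc k" for k
  proof (rule order_tendstoD(1))
    have "((\<lambda>g::real. g ^ Suc k) \<longlongrightarrow> 1 ^ Suc k) (at_left 1)" by (intro tendsto_intros)
    then show "((\<lambda>g::real. g ^ Suc k) \<longlongrightarrow> 1) (at_left 1)" by simp
  qed (rule lt)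
  then have "\<forall>\<^sub>F g in at_left (1::real). \<forall>k\<in>{..<K}. \<bar>c k\<bar> < g ^ Suc k"
    by (intro eventually_ball_finite) auto
  moreover have "\<forall>\<^sub>F g in at_left (1::real). g \<in> {h<..<1}"
    using h by (intro eventually_at_leftI) auto
  ultimately have "\<forall>\<^sub>F g in at_left (1::real). (\<forall>k\<in>{..<K}. \<bar>c k\<bar> < g ^ Suc k) \<and> g \<in> {h<..<1}"
    by (rule eventually_conj)
  then obtain g where g: "\<And>k. k < K \<Longrightarrow> \<bar>c k\<bar> < g ^ Suc k" "h < g" "g < 1"
    using eventually_happens'[OF trivial_limit_at_left_real] by fastforce
  show thesis
  proof (rule that[of g])
    fix k
    show "\<bar>c k\<bar> \<le> g ^ Suc k"
    proof (cases "k < K")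
      case True
      then show ?thesis using g(1) by (simp add: less_imp_le)
    next
      case False
      have "h ^ Suc k \<le> g ^ Suc k" using g h by (intro power_mono) auto
      with large[of k] False show ?thesis by simp
    qed
  qed (use g h in auto)
qed

lemma word_prod_carrier:
  assumes "\<And>i. i \<in> set w \<Longrightarrow> S i \<in> carrier_mat d d"
  shows "word_prod d S w \<in> carrier_mat d d"
  using assms by (induction w) (auto simp: word_prod_def intro!: mult_carrier_mat)

lemma word_prod_append:
  assumes "\<And>i. i \<in> set u \<union> set w \<Longrightarrow> S i \<in> carrier_mat d d"
  shows "word_prod d S (u @ w) = word_prod d S u * word_prod d S w"
  using assms
proof (induction u)
  case Nil
  then show ?case using word_prod_carrier[of w S d] by (simp add: word_prod_def)
next
  case (Cons i u)
  then have "word_prod d S ((i # u) @ w) = S i * (word_prod d S u * word_prod d S w)"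
    by (simp add: word_prod_def)
  also have "\<dots> = (S i * word_prod d S u) * word_prod d S w"
    using Cons.prems word_prod_carrier[of u S d] word_prod_carrier[of w S d]
    by (intro assoc_mult_mat[symmetric]) auto
  finally show ?case by (simp add: word_prod_def)
qed

lemma word_prod_replicate:
  assumes B: "S b \<in> carrier_mat d d"
  shows "word_prod d S (replicate k b) = S b ^\<^sub>m k"
proof (induction k)
  case 0
  then show ?case using B by (simp add: word_prod_def)
next
  case (Suc k)
  have "word_prod d S (replicate k b @ [b]) = word_prod d S (replicate k b) * S b"
    using B by (subst word_prod_append) (auto simp: word_prod_def)
  with Suc show ?case by (simp add: replicate_append_same)
qed

lemma two_letter_word_cases:
  assumes "set w \<subseteq> {a, b}"
  obtains k where "w = replicate k b"
    | k w' where "w = replicate k b @ a # w'" "set w' \<subseteq> {a, b}"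
proof -
  have "(\<exists>k. w = replicate k b) \<or> (\<exists>k w'. w = replicate k b @ a # w' \<and> set w' \<subseteq> {a, b})"
    using assms
  proof (induction w)
    case Nil
    show ?case by (intro disjI1 exI[of _ 0]) simp
  next
    case (Cons x w)
    show ?case
    proof (cases "x = a")
      case True
      then show ?thesis using Cons.prems by (intro disjI2 exI[of _ 0] exI[of _ w]) auto
    next
      case False
      then have x: "x = b" using Cons.prems by auto
      from Cons consider k where "w = replicate k b"
        | k w' where "w = replicate k b @ a # w'" "set w' \<subseteq> {a, b}" by auto
      then show ?thesis
      proof cases
        case (1 k)
        then show ?thesis using x by (intro disjI1 exI[of _ "Suc k"]) simp
      next
        case (2 k w')
        then show ?thesis using x by (intro disjI2 exI[of _ "Suc k"] exI[of _ w']) simp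
      qed
    qed
  qed
  then show thesis using that by blast
qed

lemma norm_bound_mono: "norm_bound A b \<Longrightarrow> b \<le> b' \<Longrightarrow> norm_bound A b'"
  unfolding norm_bound_def by (meson order_trans)

lemma norm_bound_exists:
  obtains b where "0 \<le> b" "norm_bound A b"
  using norm_bound_mono[OF norm_bound_max max.cobounded2] max.cobounded1 by blast

lemma norm_bound_smult:
  fixes A :: "real mat"
  assumes "norm_bound A b" "\<bar>c\<bar> \<le> e"
  shows "norm_bound (c \<cdot>\<^sub>m A) (e * b)"
  using assms unfolding norm_bound_def by (auto simp: abs_mult intro!: mult_mono')

text \<open>
  The bound is proved for the rows \<open>V P\<close> first, where \<open>P\<close> runs over the products: there an initial
  block \<open>B\<^sup>k A\<close> merely multiplies by the scalar \<open>c\<^sub>k\<close>, so that no constant piles up in the induction.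
  For \<open>P\<close> itself, one more such block is peeled off and costs a constant once.
\<close>

lemma word_prod_geometric_bound:
  assumes d: "0 < d" and A: "S a \<in> carrier_mat d d" and B: "S b \<in> carrier_mat d d"
    and rank: "vec_space.rank d (S a) \<le> 1"
    and rho: "\<And>w. w \<noteq> [] \<Longrightarrow> set w \<subseteq> {a, b} \<Longrightarrow> rho (word_prod d S w) < 1"
  obtains M g where "0 < M" "0 < g" "g < 1"
    "\<And>w. set w \<subseteq> {a, b} \<Longrightarrow> norm_bound (word_prod d S w) (M * g ^ length w)"
proof -
  obtain U V where U: "U \<in> carrier_mat d 1" and V: "V \<in> carrier_mat 1 d" and UV: "S a = U * V"
    using vec_space.rank_le_one_factorization[OF A rank] by blast
  have S: "S i \<in> carrier_mat d d" if "i \<in> {a, b}" for i using that A B by auto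
  have P: "word_prod d S w \<in> carrier_mat d d" if "set w \<subseteq> {a, b}" for w
    using that S by (intro word_prod_carrier) auto
  have Bk: "S b ^\<^sub>m k \<in> carrier_mat d d" for k using B by (rule pow_carrier_mat)
  have Bword: "word_prod d S (replicate k b) = S b ^\<^sub>m k" for k
    using B by (rule word_prod_replicate)
  define c where "c k = (V * S b ^\<^sub>m k * U) $$ (0, 0)" for k
  have lt: "\<bar>c k\<bar> < 1" for k
  proof -
    have "\<bar>c k\<bar> \<le> rho (U * (V * S b ^\<^sub>m k))"
      unfolding c_def using U V Bk d by (intro abs_row_times_column_le_rho) auto
    also have "U * (V * S b ^\<^sub>m k) = S a * S b ^\<^sub>m k"
      unfolding UV using U V Bk by (intro assoc_mult_mat[symmetric])
    also have "\<dots> = word_prod d S (a # replicate k b)"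
      using Bword[of k] by (simp add: word_prod_def)
    also have "rho \<dots> < 1" by (rule rho) auto
    finally show ?thesis .
  qed
  have "rho (S b) < 1" using rho[of "[b]"] B by (simp add: word_prod_def)
  then obtain M t where M: "0 < M" and t: "0 < t" "t < 1"
    and pow: "\<And>k. norm_bound (S b ^\<^sub>m k) (M * t ^ k)"
    using pow_geometric_bound[OF B d] by blast
  obtain nu where nu: "0 \<le> nu" "norm_bound U nu" by (rule norm_bound_exists)
  obtain nv where nv: "0 \<le> nv" "norm_bound V nv" by (rule norm_bound_exists)
  define D where "D = nv * M * d"
  define E where "E = M * nu * d"
  have D: "0 \<le> D" and E: "0 \<le> E" using M nu nv unfolding D_def E_def by auto
  have VB: "norm_bound (V * S b ^\<^sub>m k) (D * t ^ k)" for k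
    using norm_bound_mult[OF V Bk nv(2) pow] by (simp add: D_def mult_ac)
  have BU: "norm_bound (S b ^\<^sub>m k * U) (E * t ^ k)" for k
    using norm_bound_mult[OF Bk U pow nu(2)] by (simp add: E_def mult_ac)
  have decay: "\<bar>c k\<bar> \<le> (D * nu * d) * t ^ k" for k
  proof -
    have "norm_bound (V * S b ^\<^sub>m k * U) (D * t ^ k * nu * d)"
      using V Bk U VB nu(2) by (intro norm_bound_mult[of _ 1 d _ 1]) auto
    then show ?thesis unfolding norm_bound_def c_def using U V by (auto simp: mult_ac)
  qed
  then obtain g where g: "t \<le> g" "g < 1" and cg: "\<And>k. \<bar>c k\<bar> \<le> g ^ Suc k"
    using uniform_geometric_bound[of t c, OF t decay lt] by blast
  have g0: "0 < g" using t g by simp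
  have tg: "t ^ k \<le> g ^ k" for k using t g by (intro power_mono) auto
  have split: "word_prod d S (replicate k b @ a # w) = (S b ^\<^sub>m k * U) * (V * word_prod d S w)"
    if w: "set w \<subseteq> {a, b}" for k w
  proof -
    have "word_prod d S (replicate k b @ a # w) = S b ^\<^sub>m k * (S a * word_prod d S w)"
      using S w by (subst word_prod_append) (auto simp: Bword, simp add: word_prod_def)
    also have "S a * word_prod d S w = U * (V * word_prod d S w)"
      unfolding UV using U V P[OF w] by (rule assoc_mult_mat)
    also have "S b ^\<^sub>m k * \<dots> = (S b ^\<^sub>m k * U) * (V * word_prod d S w)"
      using Bk[of k] U V P[OF w] by (intro assoc_mult_mat[symmetric]) auto
    finally show ?thesis .
  qed
  have row: "norm_bound (V * word_prod d S w) (D * g ^ length w)" if "set w \<subseteq> {a, b}" for w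
    using that
  proof (induction "length w" arbitrary: w rule: less_induct)
    case less
    from less.prems show ?case
    proof (cases rule: two_letter_word_cases)
      case (1 k)
      show ?thesis unfolding 1 Bword
        using norm_bound_mono[OF VB[of k]] D tg[of k] by (simp add: mult_left_mono)
    next
      case (2 k w')
      have W: "V * word_prod d S w' \<in> carrier_mat 1 d" using V P[OF 2(2)] by simp
      have "V * word_prod d S w = (V * S b ^\<^sub>m k * U) * (V * word_prod d S w')"
        unfolding 2(1) split[OF 2(2)] using V Bk[of k] U W
        by (smt (verit) assoc_mult_mat mult_carrier_mat)
      also have "\<dots> = c k \<cdot>\<^sub>m (V * word_prod d S w')"
        unfolding c_def using U V W by (intro one_by_one_mult) auto
      finally have eq: "V * word_prod d S w = c k \<cdot>\<^sub>m (V * word_prod d S w')" .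
      have "norm_bound (V * word_prod d S w') (D * g ^ length w')"
        using 2 by (intro less.hyps) auto
      from norm_bound_smult[OF this cg[of k]] show ?thesis
        unfolding eq unfolding 2(1) by (simp add: power_add mult_ac)
    qed
  qed
  \<comment> \<open>\<open>M\<close> serves the powers of \<open>B\<close>. For the words that contain \<open>a\<close>, the division by \<open>g\<close>
    makes up for the letter \<open>a\<close>, which has length one but brings no factor \<open>g\<close>.\<close>
  define L where "L = M + E * D / g"
  have L: "M \<le> L" "E * D / g \<le> L" "0 < L" using M E D g0 unfolding L_def by (auto intro: add_pos_nonneg)
  have "norm_bound (word_prod d S w) (L * g ^ length w)" if "set w \<subseteq> {a, b}" for w
    using that
  proof (cases rule: two_letter_word_cases)
    case (1 k)
    have "M * t ^ k \<le> L * g ^ k" using L tg M t by (intro mult_mono) auto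
    then show ?thesis unfolding 1 Bword
      using norm_bound_mono[OF pow[of k]] by simp
  next
    case (2 k w')
    have "norm_bound (word_prod d S w) (E * t ^ k * (D * g ^ length w') * of_nat 1)"
      unfolding 2(1) split[OF 2(2)] using U V Bk[of k] P[OF 2(2)] BU row[OF 2(2)]
      by (intro norm_bound_mult[of _ d 1 _ d]) auto
    moreover have "E * t ^ k * (D * g ^ length w') * of_nat 1 \<le> L * g ^ length w"
    proof -
      have "E * t ^ k * (D * g ^ length w') \<le> E * g ^ k * (D * g ^ length w')"
        using E D g0 t tg by (intro mult_mono mult_nonneg_nonneg) auto
      also have "\<dots> = E * D / g * g ^ length w"
        unfolding 2(1) using g0 by (simp add: power_add field_simps)
      also have "\<dots> \<le> L * g ^ length w" using L g0 by (intro mult_right_mono) auto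
      finally show ?thesis by simp
    qed
    ultimately show ?thesis by (rule norm_bound_mono)
  qed
  with L(3) g0 g(2) show thesis using that by blast
qed

section \<open>Consequences for growth rates and norms\<close>

text \<open>Every matrix is a combination of the elementary matrices, whose norms are fixed numbers.\<close>

lemma matrix_norm_le_norm_bound:
  assumes N: "matrix_norm d N"
  obtains K where "0 < K" "\<And>A b. A \<in> carrier_mat d d \<Longrightarrow> norm_bound A b \<Longrightarrow> 0 \<le> b \<Longrightarrow> N A \<le> K * b"
proof -
  define el :: "nat \<times> nat \<Rightarrow> real mat" where "el p = mat d d (\<lambda>q. if q = p then 1 else 0)" for p
  have el: "el p \<in> carrier_mat d d" for p unfolding el_def by simp
  have Nel: "0 \<le> N (el p)" for p using N el[of p] unfolding matrix_norm_def by blast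
  let ?I = "{..<d} \<times> {..<d}"
  have part: "N (mat d d (\<lambda>p. if p \<in> I then A $$ p else 0)) \<le> (\<Sum>p\<in>I. \<bar>A $$ p\<bar> * N (el p))"
    (is "N (?R I) \<le> _")
    if "finite I" for A I
    using that
  proof (induction I)
    case empty
    have "?R {} = 0\<^sub>m d d" by (intro eq_matI) auto
    moreover have "N (0\<^sub>m d d) = 0" using N unfolding matrix_norm_def by (metis zero_carrier_mat)
    ultimately show ?case by simp
  next
    case (insert p I)
    have R: "?R I \<in> carrier_mat d d" by simp
    have "?R (insert p I) = (A $$ p) \<cdot>\<^sub>m el p + ?R I"
      using insert.hyps unfolding el_def by (intro eq_matI) auto
    moreover have "N ((A $$ p) \<cdot>\<^sub>m el p + ?R I) \<le> N ((A $$ p) \<cdot>\<^sub>m el p) + N (?R I)"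
      using N R el[of p] unfolding matrix_norm_def by (meson smult_carrier_mat)
    moreover have "N ((A $$ p) \<cdot>\<^sub>m el p) = \<bar>A $$ p\<bar> * N (el p)"
      using N el[of p] unfolding matrix_norm_def by blast
    ultimately show ?case using insert by simp
  qed
  define K where "K = 1 + (\<Sum>p\<in>?I. N (el p))"
  show thesis
  proof (rule that[of K])
    show "0 < K" unfolding K_def using Nel by (intro add_pos_nonneg sum_nonneg) auto
    fix A :: "real mat" and b assume A: "A \<in> carrier_mat d d" and b: "norm_bound A b" "0 \<le> b"
    have "A = mat d d (\<lambda>p. if p \<in> ?I then A $$ p else 0)" using A by (intro eq_matI) auto
    then have "N A \<le> (\<Sum>p\<in>?I. \<bar>A $$ p\<bar> * N (el p))" using part[of ?I A] by simp
    also have "\<dots> \<le> (\<Sum>p\<in>?I. b * N (el p))"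
      using b A Nel unfolding norm_bound_def by (intro sum_mono mult_right_mono) auto
    also have "\<dots> \<le> K * b" unfolding K_def sum_distrib_left[symmetric] using b by (simp add: algebra_simps)
    finally show "N A \<le> K * b" .
  qed
qed

lemma finite_words: "finite (words n)"
proof -
  have "words n = {w. set w \<subseteq> {1, 2} \<and> length w = n}" unfolding words_def by auto
  then show ?thesis by (simp add: finite_lists_length_eq)
qed

lemma words_nonempty: "words n \<noteq> {}"
proof -
  have "replicate n 1 \<in> words n" unfolding words_def by (auto simp: set_replicate_conv_if)
  then show ?thesis by blast
qed

lemma generalized_spectral_radius_less_one:
  assumes C: "0 < C" and g: "0 < g" "g < 1"
    and bound: "\<And>n w. w \<in> words n \<Longrightarrow> rho (word_prod d S w) \<le> C * g ^ n"
  shows "generalized_spectral_radius d S < 1"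
proof -
  have le: "(MAX w\<in>words n. root n (rho (word_prod d S w))) \<le> root n C * g" if n: "0 < n" for n
  proof -
    have "root n (rho (word_prod d S w)) \<le> root n C * g" if "w \<in> words n" for w
    proof -
      have "root n (rho (word_prod d S w)) \<le> root n (C * g ^ n)"
        using bound[OF that] n by simp
      also have "\<dots> = root n C * g" using g n by (simp add: real_root_mult real_root_power_cancel)
      finally show ?thesis .
    qed
    then show ?thesis using finite_words words_nonempty by (subst Max_le_iff) auto
  qed
  have "(\<lambda>n. root n C * g) \<longlonglongrightarrow> 1 * g" using C by (intro tendsto_intros LIMSEQ_root_const)
  then have "(\<lambda>n. ereal (root n C * g)) \<longlonglongrightarrow> ereal g" by simp
  then have "limsup (\<lambda>n. ereal (root n C * g)) = ereal g" by (intro lim_imp_Limsup) auto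
  moreover have "generalized_spectral_radius d S \<le> limsup (\<lambda>n. ereal (root n C * g))"
    unfolding generalized_spectral_radius_def
    using le by (intro Limsup_mono eventually_sequentiallyI[of 1]) auto
  ultimately show ?thesis using g by (metis ereal_less(3) le_less_trans)
qed

lemma limsup_elog_less_zero:
  assumes C: "0 < C" and g: "0 < g" "g < 1"
    and x: "\<And>n. 0 \<le> x n" "\<And>n. x n \<le> C * g ^ n"
  shows "limsup (\<lambda>n. ereal (1 / real n) * elog (x n)) < 0"
proof -
  have le: "ereal (1 / real n) * elog (x n) \<le> ereal (ln C / real n + ln g)" if n: "1 \<le> n" for n
  proof (cases "x n = 0")
    case True
    then show ?thesis using n by (simp add: elog_def)
  next
    case False
    then have "0 < x n" using x(1)[of n] by simp
    then have "ln (x n) \<le> ln (C * g ^ n)" using x(2)[of n] by simp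
    also have "\<dots> = ln C + n * ln g" using C g by (simp add: ln_mult ln_realpow)
    finally have "1 / real n * ln (x n) \<le> ln C / real n + ln g" using n by (simp add: field_simps)
    then show ?thesis using False by (simp add: elog_def)
  qed
  have "(\<lambda>n. ln C / real n + ln g) \<longlonglongrightarrow> 0 + ln g"
    by (intro tendsto_intros lim_const_over_n)
  then have "(\<lambda>n. ereal (ln C / real n + ln g)) \<longlonglongrightarrow> ereal (ln g)" by simp
  then have "limsup (\<lambda>n. ereal (ln C / real n + ln g)) = ereal (ln g)"
    by (intro lim_imp_Limsup) auto
  moreover have "limsup (\<lambda>n. ereal (1 / real n) * elog (x n))
      \<le> limsup (\<lambda>n. ereal (ln C / real n + ln g))"
    using le by (intro Limsup_mono eventually_sequentiallyI[of 1]) auto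
  moreover have "ereal (ln g) < 0" using g by simp
  ultimately show ?thesis by (metis le_less_trans)
qed

theorem theorem1p4:
  fixes d :: nat and S :: "nat \<Rightarrow> real mat"
  assumes "2 \<le> d"
    and "S 1 \<in> carrier_mat d d" and "S 2 \<in> carrier_mat d d"
    and "vec_space.rank d (S 1) = 1 \<or> vec_space.rank d (S 2) = 1"
    and "\<forall>A\<in>semigroup_gen d S. rho A < 1"
  shows "generalized_spectral_radius d S < 1 \<and>
    (\<forall>N. matrix_norm d N \<longrightarrow>
       absolutely_asymptotically_stable N d S \<and> absolutely_exponentially_stable N d S)"
proof -
  have d: "0 < d" using assms(1) by simp
  have rho: "rho (word_prod d S w) < 1" if "w \<noteq> []" "set w \<subseteq> {1, 2}" for w
  proof -
    have "word_prod d S w \<in> semigroup_gen d S"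
      unfolding semigroup_gen_def words_def using that
      by (intro CollectI exI[of _ w] exI[of _ "length w"]) (auto simp: Suc_le_eq)
    then show ?thesis using assms(5) by blast
  qed
  obtain a b where ab: "{a, b} = {1, 2 :: nat}" and rank: "vec_space.rank d (S a) \<le> 1"
    using assms(4) by (metis insert_commute order_refl)
  have "S a \<in> carrier_mat d d" "S b \<in> carrier_mat d d"
    using ab assms(2,3) by (metis insertCI insertE singletonD)+
  from word_prod_geometric_bound[OF d this rank, unfolded ab, OF rho]
  obtain M g where M: "0 < M" and g: "0 < g" "g < 1"
    and bound: "\<And>w. set w \<subseteq> {1, 2} \<Longrightarrow> norm_bound (word_prod d S w) (M * g ^ length w)"
    by blast
  have P: "word_prod d S w \<in> carrier_mat d d" if "set w \<subseteq> {1, 2}" for w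
    using that assms(2,3) by (intro word_prod_carrier) auto
  have "generalized_spectral_radius d S < 1"
  proof (rule generalized_spectral_radius_less_one[where C = "real d * M", OF _ g])
    show "0 < real d * M" using d M by simp
    fix n w assume "w \<in> words n"
    then have w: "length w = n" "set w \<subseteq> {1, 2}" unfolding words_def by auto
    from rho_le_norm_bound[OF P[OF w(2)] d bound[OF w(2)]]
    show "rho (word_prod d S w) \<le> real d * M * g ^ n" by (simp add: w mult_ac)
  qed
  moreover have "absolutely_asymptotically_stable N d S \<and> absolutely_exponentially_stable N d S"
    if N: "matrix_norm d N" for N
  proof -
    obtain K where K: "0 < K"
      and NK: "\<And>A b. A \<in> carrier_mat d d \<Longrightarrow> norm_bound A b \<Longrightarrow> 0 \<le> b \<Longrightarrow> N A \<le> K * b"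
      using matrix_norm_le_norm_bound[OF N] by blast
    have N_bounds: "0 \<le> N (signal_prod d S i n)" "N (signal_prod d S i n) \<le> K * M * g ^ n"
      if i: "switching_signal i" for i n
    proof -
      let ?w = "map i [1..<Suc n]"
      have w: "set ?w \<subseteq> {1, 2}" using i unfolding switching_signal_def by auto
      show "0 \<le> N (signal_prod d S i n)"
        using N P[OF w] unfolding matrix_norm_def signal_prod_def by blast
      have "0 \<le> M * g ^ length ?w" using M g by simp
      from NK[OF P[OF w] bound[OF w] this]
      show "N (signal_prod d S i n) \<le> K * M * g ^ n"
        unfolding signal_prod_def by (simp add: mult_ac del: upt_Suc)
    qed
    have "(\<lambda>n. N (signal_prod d S i n)) \<longlonglongrightarrow> 0" if i: "switching_signal i" for i
    proof (rule tendsto_sandwich[OF _ _ tendsto_const])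
      have "(\<lambda>n. K * M * g ^ n) \<longlonglongrightarrow> K * M * 0"
        using g by (intro tendsto_intros LIMSEQ_power_zero) auto
      then show "(\<lambda>n. K * M * g ^ n) \<longlonglongrightarrow> 0" by simp
    qed (use N_bounds[OF i] in auto)
    moreover have "limsup (\<lambda>n. ereal (1 / real n) * elog (N (signal_prod d S i n))) < 0"
      if i: "switching_signal i" for i
      using limsup_elog_less_zero[OF mult_pos_pos[OF K M] g N_bounds[OF i]] .
    ultimately show ?thesis
      unfolding absolutely_asymptotically_stable_def absolutely_exponentially_stable_def by blast
  qed
  ultimately show ?thesis by blast
qed

end
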